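(* Let $N\ge 2$ and let $\mathcal{G}=(\mathcal{V},\mathcal{E},\mathbf{A})$ be a connected undirected weighted graph on $\mathcal{V}=\{1,\dots,N\}$, with Laplacian $\mathbf{L}$ having eigenvalues $0=\lambda_1<\lambda_2\le\cdots\le\lambda_N$. Let $\delta\in(0,\frac{2}{\lambda_N})$. For each integer $d\ge 0$ let $\mathfrak{r}_d$ denote the convergence factor of the buffered Laplacian average consensus algorithm with buffer $d$ (defined in the context; $d=0$ is the ordinary Laplacian algorithm). (1) Let $d\in\mathbb{Z}_{>0}$. If for all $i\in\{2,\dots,N\}$ $$d<\min\left\{\frac{\ln\left(\frac{\delta\lambda_i}{\sqrt{(1-\delta\lambda_i)^2+1-2|1-\delta\lambda_i|\cos\phi_i}}\right)}{\ln(|1-\delta\lambda_i|)},\ \frac{|1-\delta\lambda_i|}{1-|1-\delta\lambda_i|}\right\},$$ where $\phi_i\in[0,\frac{\pi}{d+1}]$ is the solution of $\frac{\sin(d\phi_i)}{\sin((d+1)\phi_i)}=|1-\delta\lambda_i|$, then $\mathfrak{r}_d<\mathfrak{r}_0$. (2) Moreover, $\mathfrak{r}_d$ is a decreasing function of $d\in\mathbb{Z}_{>0}$ over those $d$ for which $\delta\lambda_i<\frac{d^d}{(d+1)^{d+1}}$ holds for all $i\in\{2,\dots,N\}$.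
   Context: The adjacency matrix $\mathbf{A}=[a_{ij}]$ is symmetric with $a_{ii}=0$, $a_{ij}=a_{ji}>0$ if $(i,j)\in\mathcal{E}$ and $a_{ij}=0$ otherwise. The Laplacian is $\mathbf{L}=\mathrm{Diag}(\mathbf{A}\mathbf{1}_N)-\mathbf{A}$; for a connected undirected graph it is symmetric positive semidefinite with simple eigenvalue $0$. Buffered Laplacian average consensus algorithm with buffer $d\in\mathbb{Z}_{\ge0}$, stepsize $\delta$, and local inputs $\mathsf{r}^i\in\mathbb{R}$: for $i\in\mathcal{V}$ and $k\ge 0$, $$x^i(k+1)=x^i(k)+\delta\sum_{j=1}^N a_{ij}\big(x^j(k-d)-x^i(k-d)\big),$$ with $x^i(0)=\mathsf{r}^i$ and $x^i(k)=0$ for $k\in\{-d,\dots,-1\}$; that is, $\mathbf{x}(k+1)=\mathbf{x}(k)-\delta\mathbf{L}\mathbf{x}(k-d)$. In an orthonormal eigenbasis of $\mathbf{L}$ the algorithm decouples into scalar dynamics: $z_1(k+1)=z_1(k)$ and $z_i(k+1)=z_i(k)-\delta\lambda_i z_i(k-d)$ for $i\in\{2,\dots,N\}$. The convergence factor of the scalar dynamics for $i\in\{2,\dots,N\}$ is the largest modulus of the roots of its characteristic polynomial, $$\mathfrak{r}_{d,i}=\max\{|s| : s\in\mathbb{C},\ s^{d+1}-s^d+\delta\lambda_i=0\},$$ and the convergence factor of the algorithm with buffer $d$ is $\mathfrak{r}_d=\max_{2\le i\le N}\mathfrak{r}_{d,i}$. In particular $\mathfrak{r}_0=\max\{|1-\delta\lambda_2|,|1-\delta\lambda_N|\}$.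 A smaller convergence factor means faster convergence. *)

theory Defs
  imports
    "HOL-Analysis.Analysis"
    "Jordan_Normal_Form.Char_Poly"
    "Graph_Theory.Pair_Digraph"
    "Graph_Theory.Digraph_Component"
begin

text \<open>
  Weighted graphs with \<open>N\<close> nodes have the vertex set \<open>{0..<N}\<close>, because matrices are indexed from 0;
  eigenvalues keep the customary indices \<open>1, \<dots>, N\<close>. An undirected edge is a pair of opposite arcs.
\<close>

definition adjacency_matrix_of :: "nat pair_pre_digraph \<Rightarrow> nat \<Rightarrow> real mat \<Rightarrow> bool" where
  "adjacency_matrix_of G N A \<longleftrightarrow>
     A \<in> carrier_mat N N \<and>
     (\<forall>i<N. A $$ (i, i) = 0) \<and>
     (\<forall>i<N. \<forall>j<N.
        (if (i, j) \<in> parcs G then A $$ (i, j) = A $$ (j, i) \<and> A $$ (i, j) > 0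
         else A $$ (i, j) = 0))"

definition connected_weighted_graph :: "nat pair_pre_digraph \<Rightarrow> nat \<Rightarrow> real mat \<Rightarrow> bool" where
  "connected_weighted_graph G N A \<longleftrightarrow>
     pair_graph G \<and> pverts G = {0..<N} \<and> Digraph_Component.connected (with_proj G) \<and>
     adjacency_matrix_of G N A"

definition laplacian :: "real mat \<Rightarrow> real mat" where
  "laplacian A = mat_diag (dim_row A) (\<lambda>i. (A *\<^sub>v vec (dim_col A) (\<lambda>_. 1)) $ i) - A"

text \<open>The eigenvalues in increasing order, repeated according to multiplicity.\<close>

definition ordered_eigenvalues :: "real mat \<Rightarrow> nat \<Rightarrow> (nat \<Rightarrow> real) \<Rightarrow> bool" where
  "ordered_eigenvalues L N lam \<longleftrightarrow>
     char_poly L = (\<Prod>i\<in>{1..N}. [:- lam i, 1:]) \<and> mono_on {1..N} lam"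

text \<open>
  Substituting \<open>z k = s ^ k\<close> into \<open>z (k + 1) = z k - c * z (k - d)\<close>, where \<open>c\<close> is the stepsize times
  an eigenvalue, gives the characteristic equation below.
\<close>

definition scalar_conv_factor :: "nat \<Rightarrow> real \<Rightarrow> real" where
  "scalar_conv_factor d c =
     Max {cmod s | s :: complex. s ^ (d + 1) - s ^ d + complex_of_real c = 0}"

text \<open>
  The convergence factor of the buffered algorithm
  \<open>x (k + 1) = x k - \<delta> L (x (k - d))\<close> when the Laplacian \<open>L\<close> has the ordered eigenvalues
  \<open>lam 1, \<dots>, lam N\<close>; the mode of \<open>lam 1 = 0\<close> is the preserved average and does not count.
\<close>

definition conv_factor :: "nat \<Rightarrow> (nat \<Rightarrow> real) \<Rightarrow> real \<Rightarrow> nat \<Rightarrow> real" where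
  "conv_factor N lam \<delta> d = Max ((\<lambda>i. scalar_conv_factor d (\<delta> * lam i)) ` {2..N})"

text \<open>
  At \<open>\<phi> = 0\<close> the quotient of sines is \<open>0 / 0 = 0\<close> here, instead of its limit \<open>d / (d + 1)\<close>.
  This does not affect \<open>buffer_condition\<close>: a solution \<open>\<phi> = 0\<close>
  means \<open>\<rho> = 0\<close> here and \<open>\<rho> = d / (d + 1)\<close> with the limit, and in both cases
  \<open>d < \<rho> / (1 - \<rho>)\<close> fails.
\<close>

definition is_phase :: "nat \<Rightarrow> real \<Rightarrow> real \<Rightarrow> bool" where
  "is_phase d \<rho> \<phi> \<longleftrightarrow>
     \<phi> \<in> {0 .. pi / real (d + 1)} \<and> sin (real d * \<phi>) / sin (real (d + 1) * \<phi>) = \<rho>"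

definition buffer_condition :: "nat \<Rightarrow> real \<Rightarrow> real \<Rightarrow> bool" where
  "buffer_condition d c \<phi> \<longleftrightarrow>
     real d < min (ln (c / sqrt ((1 - c)\<^sup>2 + 1 - 2 * \<bar>1 - c\<bar> * cos \<phi>)) / ln \<bar>1 - c\<bar>)
                  (\<bar>1 - c\<bar> / (1 - \<bar>1 - c\<bar>))"

end

theory Submission
  imports Defs "Jordan_Normal_Form.Schur_Decomposition"
begin

text \<open>
  The largest modulus over the modes decreases strictly as soon as it does so for every mode, so
  both claims concern a single characteristic equation \<open>s ^ d * (1 - s) = c\<close> with gain
  \<open>0 < c < 2\<close>. The upper bound is the condition on the stepsize; the lower bound holds because the
  second smallest eigenvalue of a connected Laplacian is positive
  (\<open>laplacian_second_eigenvalue_pos\<close>).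

  For the comparison with \<open>d = 0\<close>, where the factor is \<open>\<rho> = \<bar>1 - c\<bar>\<close>, the equation is read in polar
  coordinates. Its imaginary part says \<open>r * sin ((d + 1) \<theta>) = sin (d \<theta>)\<close>. The roots with angle
  in \<open>(0, pi / (d + 1))\<close>, for varying \<open>c\<close>, form a branch that leaves the positive axis at
  \<open>d / (d + 1)\<close>; modulus and gain increase along it. The angle \<open>\<phi>\<close> is where the branch crosses the
  circle of radius \<open>\<rho>\<close>, and the condition on \<open>d\<close> says that \<open>c\<close> is smaller than the gain needed to
  reach this crossing. All other nonreal or negative roots lie at larger angles and need an even
  larger gain to reach a given circle, while a positive root beyond \<open>\<rho> > d / (d + 1)\<close> would need a
  smaller gain. So all roots are inside the disc of radius \<open>\<rho>\<close>
  (\<open>roots_inside_disc\<close>, \<open>buffer_condition_accelerates\<close>).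

  For the monotonicity, a gain below the threshold \<open>d ^ d / (d + 1) ^ (d + 1)\<close>, which is the maximum
  of \<open>x ^ d * (1 - x)\<close>, gives a real root \<open>x\<close> in \<open>(d / (d + 1), 1)\<close>. This root dominates all
  others (\<open>real_root_dominates\<close>), and it moves left as \<open>d\<close> grows
  (\<open>scalar_conv_factor_decreasing\<close>).
\<close>

section \<open>Monotone real functions\<close>

text \<open>
  The expression is the numerator in the derivative of \<open>sin (a x) / sin (b x)\<close>. It vanishes
  at \<open>0\<close>, and its own derivative \<open>(b\<^sup>2 - a\<^sup>2) sin (a x) sin (b x)\<close> is positive.
\<close>
lemma sin_quotient_derivative_numerator_pos:
  fixes a b x :: real
  assumes "0 < a" "a < b" "0 < x" "b * x < pi"
  shows "a * cos (a * x) * sin (b * x) - b * sin (a * x) * cos (b * x) > 0"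
proof -
  define h where "h t = a * cos (a * t) * sin (b * t) - b * sin (a * t) * cos (b * t)" for t
  have "h 0 < h x"
  proof (rule DERIV_pos_imp_increasing_open[OF assms(3)])
    fix t assume t: "0 < t" "t < x"
    have bt: "b * t < pi" using t assms by (meson less_trans mult_strict_left_mono order_less_trans)
    have at: "a * t < pi" using bt t assms by (meson less_trans mult_strict_right_mono)
    have "(h has_real_derivative (b\<^sup>2 - a\<^sup>2) * sin (a * t) * sin (b * t)) (at t)"
      unfolding h_def
      by (auto intro!: derivative_eq_intros simp: algebra_simps power2_eq_square)
    moreover have "(b\<^sup>2 - a\<^sup>2) * sin (a * t) * sin (b * t) > 0"
      using at bt t assms by (intro mult_pos_pos sin_gt_zero) (auto simp: power_strict_mono)
    ultimately show "\<exists>y. (h has_real_derivative y) (at t) \<and> y > 0" by blast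
  next
    show "continuous_on {0..x} h" unfolding h_def by (intro continuous_intros)
  qed
  then show ?thesis by (simp add: h_def)
qed

text \<open>
  With \<open>a = d\<close>, \<open>b = d + 1\<close> the quotient is the modulus of a root at angle \<open>x\<close>; with \<open>a = 1\<close>,
  \<open>b = d + 1\<close> it is the angular factor of the gain that produces this root. Both uses are in
  \<open>roots_inside_disc\<close>.
\<close>
lemma sin_quotient_strict_mono:
  fixes a b x y :: real
  assumes "0 < a" "a < b" "0 < x" "x < y" "b * y < pi"
  shows "sin (a * x) / sin (b * x) < sin (a * y) / sin (b * y)"
proof (rule DERIV_pos_imp_increasing[OF assms(4)])
  fix t assume t: "x \<le> t" "t \<le> y"
  have t0: "0 < t" using t assms by simp
  have bt: "b * t < pi" using t assms
    by (meson le_less_trans less_trans mult_le_cancel_left_pos)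
  have s: "sin (b * t) > 0" using bt t0 assms by (intro sin_gt_zero) auto
  have "((\<lambda>t. sin (a * t) / sin (b * t)) has_real_derivative
          (a * cos (a * t) * sin (b * t) - b * sin (a * t) * cos (b * t)) / (sin (b * t) * sin (b * t))) (at t)"
    using s by (auto intro!: derivative_eq_intros simp: algebra_simps)
  moreover have "(a * cos (a * t) * sin (b * t) - b * sin (a * t) * cos (b * t)) / (sin (b * t) * sin (b * t)) > 0"
    using sin_quotient_derivative_numerator_pos[OF assms(1,2) t0 bt] s by simp
  ultimately show "\<exists>D. ((\<lambda>t. sin (a * t) / sin (b * t)) has_real_derivative D) (at t) \<and> D > 0"
    by blast
qed

text \<open>
  The derivative \<open>t ^ (d - 1) * (d - (d + 1) * t)\<close> changes sign at \<open>d / (d + 1)\<close>; the maximum of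
  \<open>t ^ d * (1 - t)\<close> on the positive axis is therefore the threshold \<open>d ^ d / (d + 1) ^ (d + 1)\<close>
  below which there are positive roots.
\<close>
lemma power_times_complement_strict_antimono:
  fixes x y :: real
  assumes "d > 0" "real d / real (d + 1) \<le> x" "x < y"
  shows "y ^ d * (1 - y) < x ^ d * (1 - x)"
proof -
  obtain k where d: "d = Suc k" using assms(1) by (cases d) auto
  show ?thesis
  proof (rule DERIV_neg_imp_decreasing_open[OF assms(3)])
    fix t assume t: "x < t" "t < y"
    have gt: "real d / real (d + 1) < t" using t assms by linarith
    then have t0: "t > 0" using assms(1) by (meson divide_nonneg_nonneg le_less_trans of_nat_0_le_iff)
    have "real d - real (d + 1) * t < 0" using gt by (simp add: field_simps)
    then have "t ^ k * (real d - real (d + 1) * t) < 0" using t0 by (simp add: mult_pos_neg)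
    moreover have "((\<lambda>t. t ^ d * (1 - t)) has_real_derivative t ^ k * (real d - real (d + 1) * t)) (at t)"
      by (rule DERIV_cong[OF DERIV_mult[OF DERIV_pow DERIV_diff[OF DERIV_const DERIV_ident]]])
        (simp add: d algebra_simps)
    ultimately show "\<exists>D. ((\<lambda>t. t ^ d * (1 - t)) has_real_derivative D) (at t) \<and> D < 0" by blast
  qed (intro continuous_intros)
qed

section \<open>Location of the characteristic roots\<close>

text \<open>
  Real and imaginary part of the characteristic equation at \<open>s = r * cis \<theta>\<close>. The pair of equations
  is invariant under \<open>\<theta> \<mapsto> - \<theta>\<close>, so angles in \<open>[0, pi]\<close> suffice.
\<close>
definition polar_root :: "nat \<Rightarrow> real \<Rightarrow> real \<Rightarrow> real \<Rightarrow> bool" where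
  "polar_root d c r \<theta> \<longleftrightarrow>
     r ^ (d + 1) * cos (real (d + 1) * \<theta>) - r ^ d * cos (real d * \<theta>) + c = 0 \<and>
     r ^ (d + 1) * sin (real (d + 1) * \<theta>) - r ^ d * sin (real d * \<theta>) = 0"

lemma polar_root_of_root:
  fixes s :: complex
  assumes "s ^ (d + 1) - s ^ d + complex_of_real c = 0"
  obtains \<theta> where "0 \<le> \<theta>" "\<theta> \<le> pi" "polar_root d c (cmod s) \<theta>"
proof -
  have s: "s = complex_of_real (cmod s) * cis (Arg s)"
    by (metis rcis_cmod_Arg rcis_def)
  have pw: "s ^ n = complex_of_real (cmod s ^ n) * cis (real n * Arg s)" for n
    by (subst s) (simp add: power_mult_distrib Complex.DeMoivre)
  have eq: "complex_of_real (cmod s ^ (d + 1)) * cis (real (d + 1) * Arg s)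
      - complex_of_real (cmod s ^ d) * cis (real d * Arg s) + complex_of_real c = 0"
    using assms unfolding pw .
  have re: "cmod s ^ (d + 1) * cos (real (d + 1) * Arg s) - cmod s ^ d * cos (real d * Arg s) + c = 0"
    using arg_cong[OF eq, of Re] by (simp del: of_real_power power_Suc of_nat_add of_nat_Suc)
  have im: "cmod s ^ (d + 1) * sin (real (d + 1) * Arg s) - cmod s ^ d * sin (real d * Arg s) = 0"
    using arg_cong[OF eq, of Im] by (simp del: of_real_power power_Suc of_nat_add of_nat_Suc)
  have "polar_root d c (cmod s) \<bar>Arg s\<bar>"
    using re im unfolding polar_root_def by (cases "Arg s \<ge> 0") (auto simp: abs_if)
  then show ?thesis using that[of "\<bar>Arg s\<bar>"] Arg_bounded[of s] by auto
qed

text \<open>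
  The squared modulus of \<open>s ^ d * (1 - s) = c\<close> retains the angle only through \<open>cos \<theta>\<close>, which makes
  roots of the same modulus at different angles comparable.
\<close>
lemma polar_root_modulus:
  assumes "polar_root d c r \<theta>"
  shows "(r ^ d)\<^sup>2 * (1 + r\<^sup>2 - 2 * r * cos \<theta>) = c\<^sup>2"
proof -
  let ?a = "real d * \<theta>" and ?b = "real (d + 1) * \<theta>"
  have c: "c = r ^ d * (cos ?a - r * cos ?b)" and z: "0 = r ^ d * (sin ?a - r * sin ?b)"
    using assms by (simp_all add: polar_root_def algebra_simps)
  have cd: "cos \<theta> = cos ?b * cos ?a + sin ?b * sin ?a"
    using cos_diff[of ?b ?a] by (simp add: algebra_simps)
  have expand: "(A - r * C)\<^sup>2 + (B - r * D)\<^sup>2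
      = (A\<^sup>2 + B\<^sup>2) + r\<^sup>2 * (C\<^sup>2 + D\<^sup>2) - 2 * r * (C * A + D * B)" for A B C D :: real
    by (simp add: power2_eq_square algebra_simps)
  have "c\<^sup>2 = c\<^sup>2 + 0\<^sup>2" by simp
  also have "\<dots> = (r ^ d)\<^sup>2 * ((cos ?a - r * cos ?b)\<^sup>2 + (sin ?a - r * sin ?b)\<^sup>2)"
    by (subst c, subst z) (simp add: power_mult_distrib distrib_left)
  also have "(cos ?a - r * cos ?b)\<^sup>2 + (sin ?a - r * sin ?b)\<^sup>2
      = ((cos ?a)\<^sup>2 + (sin ?a)\<^sup>2) + r\<^sup>2 * ((cos ?b)\<^sup>2 + (sin ?b)\<^sup>2) - 2 * r * (cos ?b * cos ?a + sin ?b * sin ?a)"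
    by (rule expand)
  also have "\<dots> = 1 + r\<^sup>2 - 2 * r * cos \<theta>" unfolding cd by simp
  finally show ?thesis by simp
qed

text \<open>
  Prescribing the angle instead of the gain: the imaginary part fixes the modulus, and then
  the real part fixes the gain for which the point is a root.
\<close>
lemma polar_root_on_branch:
  assumes "r * sin (real (d + 1) * \<theta>) = sin (real d * \<theta>)" "sin (real (d + 1) * \<theta>) \<noteq> 0"
  shows "polar_root d (r ^ d * (sin \<theta> / sin (real (d + 1) * \<theta>))) r \<theta>"
proof -
  let ?a = "real d * \<theta>" and ?b = "real (d + 1) * \<theta>"
  have sd: "sin \<theta> = sin ?b * cos ?a - cos ?b * sin ?a"
    using sin_diff[of ?b ?a] by (simp add: algebra_simps)
  have q: "sin \<theta> / sin ?b = cos ?a - r * cos ?b"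
    unfolding sd assms(1)[symmetric] using assms(2) by (simp add: divide_simps algebra_simps)
  then show ?thesis
    unfolding polar_root_def q assms(1)[symmetric] by (simp add: algebra_simps)
qed

text \<open>
  For angles in \<open>(0, pi / (d + 1))\<close> the points \<open>r * cis \<theta>\<close> with \<open>s ^ d * (1 - s)\<close> positive form one
  branch, along which \<open>r\<close> and the gain both increase; \<open>upper\<close> says that \<open>c\<close> is less than the gain at
  the branch point of modulus \<open>\<rho>\<close>. A root of modulus \<open>r \<ge> \<rho>\<close> is compared with the branch point
  of the same modulus \<open>r\<close>, whose gain is at least that large. At a larger angle the root is
  farther from \<open>1\<close>, so \<open>r ^ d * cmod (1 - s) = c\<close> would be too large. At a smaller positive angle it
  would lie on the branch, where distinct angles have distinct moduli. On the positive real axis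
  the gain \<open>r ^ d * (1 - r)\<close> would be too small, by \<open>lower\<close>.
\<close>
lemma roots_inside_disc:
  fixes s :: complex
  assumes d: "d > 0" and \<rho>: "real d / real (d + 1) < \<rho>"
    and \<phi>: "0 < \<phi>" "real (d + 1) * \<phi> < pi"
    and branch: "\<rho> * sin (real (d + 1) * \<phi>) = sin (real d * \<phi>)"
    and lower: "\<rho> ^ d * (1 - \<rho>) < c"
    and upper: "c < \<rho> ^ d * sqrt (1 + \<rho>\<^sup>2 - 2 * \<rho> * cos \<phi>)"
    and root: "s ^ (d + 1) - s ^ d + complex_of_real c = 0"
    and c0: "0 < c"
  shows "cmod s < \<rho>"
proof (rule ccontr)
  define r where "r = cmod s"
  assume "\<not> cmod s < \<rho>"
  then have r\<rho>: "\<rho> \<le> r" by (simp add: r_def)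
  have \<rho>0: "0 < \<rho>" using \<rho> by (meson divide_nonneg_nonneg le_less_trans of_nat_0_le_iff)
  have r0: "0 < r" using r\<rho> \<rho>0 by simp
  obtain \<theta> where \<theta>: "0 \<le> \<theta>" "\<theta> \<le> pi" and pr: "polar_root d c r \<theta>"
    using polar_root_of_root[OF root] unfolding r_def by blast
  have pos: "sin (real (d + 1) * t) > 0" if "0 < t" "real (d + 1) * t < pi" for t
    using that by (intro sin_gt_zero) auto
  let ?e = "pi / real (d + 1)"
  have \<phi>e: "\<phi> < ?e" using \<phi> by (simp add: field_simps)
  have endpoint: "sin (real d * ?e) > 0" "sin (real (d + 1) * ?e) = 0"
  proof -
    have "real d * ?e < pi" "0 < real d * ?e" using d by (simp_all add: field_simps)
    then show "sin (real d * ?e) > 0" by (intro sin_gt_zero)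
    show "sin (real (d + 1) * ?e) = 0" by (simp del: of_nat_add of_nat_Suc)
  qed
  \<comment> \<open>As the angle grows from \<open>\<phi>\<close> to \<open>pi / (d + 1)\<close>, the branch modulus grows from \<open>\<rho>\<close> without
    bound, so it takes the value \<open>r\<close>. Clearing the denominator keeps the endpoint in play.\<close>
  obtain \<theta>r where "\<phi> \<le> \<theta>r" "\<theta>r \<le> ?e" and \<theta>r0: "r * sin (real (d + 1) * \<theta>r) - sin (real d * \<theta>r) = 0"
  proof -
    have "\<exists>x\<ge>\<phi>. x \<le> ?e \<and> r * sin (real (d + 1) * x) - sin (real d * x) = 0"
    proof (rule IVT2')
      show "r * sin (real (d + 1) * ?e) - sin (real d * ?e) \<le> 0"
        using endpoint by simp
      show "0 \<le> r * sin (real (d + 1) * \<phi>) - sin (real d * \<phi>)"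
        unfolding branch[symmetric] using pos[OF \<phi>] r\<rho> by (simp add: mult_right_mono)
      show "\<phi> \<le> ?e" using \<phi>e by simp
      show "continuous_on {\<phi>..?e} (\<lambda>x. r * sin (real (d + 1) * x) - sin (real d * x))"
        by (intro continuous_intros)
    qed
    then show ?thesis using that by blast
  qed
  moreover have "\<theta>r \<noteq> ?e" using \<theta>r0 endpoint by auto
  ultimately have \<theta>r: "\<phi> \<le> \<theta>r" "real (d + 1) * \<theta>r < pi" "0 < \<theta>r"
    using \<phi> by (auto simp: field_simps)
  have \<theta>rb: "r * sin (real (d + 1) * \<theta>r) = sin (real d * \<theta>r)" using \<theta>r0 by simp
  define C where "C = r ^ d * (sin \<theta>r / sin (real (d + 1) * \<theta>r))"
  define C\<phi> where "C\<phi> = \<rho> ^ d * (sin \<phi> / sin (real (d + 1) * \<phi>))"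
  have \<phi>pi: "\<phi> < pi" "\<theta>r < pi"
    using \<theta>r \<phi> d by (smt (verit) mult_less_cancel_right1 of_nat_0_less_iff of_nat_1 of_nat_add)+
  have "sin \<phi> / sin (real (d + 1) * \<phi>) \<le> sin \<theta>r / sin (real (d + 1) * \<theta>r)"
  proof (cases "\<phi> = \<theta>r")
    case False
    then show ?thesis
      using sin_quotient_strict_mono[of 1 "real (d + 1)" \<phi> \<theta>r] \<phi> \<theta>r d by simp
  qed simp
  moreover have "sin \<phi> / sin (real (d + 1) * \<phi>) > 0"
    using pos[OF \<phi>] \<phi>pi \<phi> by (simp add: sin_gt_zero)
  moreover have "\<rho> ^ d \<le> r ^ d" "0 < \<rho> ^ d" using \<rho>0 r\<rho> by (auto intro: power_mono)
  ultimately have CC: "0 < C\<phi>" "C\<phi> \<le> C"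
    unfolding C_def C\<phi>_def by (blast intro: mult_pos_pos, smt (verit) mult_mono)
  have C2: "(r ^ d)\<^sup>2 * (1 + r\<^sup>2 - 2 * r * cos \<theta>r) = C\<^sup>2"
    unfolding C_def using \<theta>r \<theta>rb pos
    by (intro polar_root_modulus polar_root_on_branch) (auto simp: less_imp_neq[symmetric])
  have C\<phi>2: "(\<rho> ^ d)\<^sup>2 * (1 + \<rho>\<^sup>2 - 2 * \<rho> * cos \<phi>) = C\<phi>\<^sup>2"
    unfolding C\<phi>_def using \<phi> branch pos
    by (intro polar_root_modulus polar_root_on_branch) (auto simp: less_imp_neq[symmetric])
  have "C\<phi> = sqrt (C\<phi>\<^sup>2)" using CC by simp
  also have "\<dots> = \<rho> ^ d * sqrt (1 + \<rho>\<^sup>2 - 2 * \<rho> * cos \<phi>)"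
    unfolding C\<phi>2[symmetric] using \<rho>0 by (simp add: real_sqrt_mult)
  finally have cC: "c < C\<phi>" using upper by simp
  consider "\<theta>r \<le> \<theta>" | "\<theta> = 0" | "0 < \<theta>" "\<theta> < \<theta>r" using \<theta> by linarith
  then show False
  proof cases
    case 1
    have "cos \<theta> \<le> cos \<theta>r" using 1 \<theta> \<theta>r by (intro cos_monotone_0_pi_le) auto
    then have "(r ^ d)\<^sup>2 * (1 + r\<^sup>2 - 2 * r * cos \<theta>r) \<le> (r ^ d)\<^sup>2 * (1 + r\<^sup>2 - 2 * r * cos \<theta>)"
      using r0 by (intro mult_left_mono) auto
    then have "C\<^sup>2 \<le> c\<^sup>2" using C2 polar_root_modulus[OF pr] by simp
    then have "C \<le> c" using c0 by (simp add: power2_le_iff_abs_le CC)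
    then show False using CC cC by simp
  next
    case 2
    have "c = r ^ d * (1 - r)" using pr unfolding polar_root_def 2 by (simp add: algebra_simps)
    moreover have "r ^ d * (1 - r) \<le> \<rho> ^ d * (1 - \<rho>)"
      using power_times_complement_strict_antimono[OF d less_imp_le[OF \<rho>], of r] r\<rho>
      by (cases "\<rho> = r") auto
    ultimately show False using lower by simp
  next
    case 3
    have "real (d + 1) * \<theta> < real (d + 1) * \<theta>r" using 3 by (intro mult_strict_left_mono) auto
    then have lt: "real (d + 1) * \<theta> < pi" using \<theta>r by linarith
    have "r ^ d * (r * sin (real (d + 1) * \<theta>)) = r ^ d * sin (real d * \<theta>)"
      using pr by (simp add: polar_root_def algebra_simps)
    then have "r * sin (real (d + 1) * \<theta>) = sin (real d * \<theta>)" using r0 by simp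
    then have "r = sin (real d * \<theta>) / sin (real (d + 1) * \<theta>)"
      using pos[OF 3(1) lt] by (simp add: field_simps)
    moreover have "r = sin (real d * \<theta>r) / sin (real (d + 1) * \<theta>r)"
      using pos[of \<theta>r] \<theta>r \<theta>rb by (simp add: field_simps)
    ultimately show False
      using sin_quotient_strict_mono[of "real d" "real (d + 1)" \<theta> \<theta>r] 3 \<theta>r d by simp
  qed
qed

section \<open>The convergence factor of a scalar mode\<close>

lemma root_moduli_finite_nonempty:
  shows "finite {cmod s | s :: complex. s ^ (d + 1) - s ^ d + complex_of_real c = 0}"
    and "{cmod s | s :: complex. s ^ (d + 1) - s ^ d + complex_of_real c = 0} \<noteq> {}"
proof -
  define p :: "complex poly" where "p = monom 1 (d + 1) - monom 1 d + [:complex_of_real c:]"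
  have ev: "poly p s = s ^ (d + 1) - s ^ d + complex_of_real c" for s
    by (simp add: p_def poly_monom)
  have "coeff p (d + 1) = 1" by (simp add: p_def)
  then have p0: "p \<noteq> 0" and deg: "degree p \<noteq> 0"
    using le_degree[of p "d + 1"] by auto
  have "{cmod s | s :: complex. s ^ (d + 1) - s ^ d + complex_of_real c = 0} = cmod ` {s. poly p s = 0}"
    by (auto simp: ev)
  moreover have "finite {s. poly p s = 0}" using p0 by (rule poly_roots_finite)
  moreover have "\<exists>s. poly p s = 0"
    using deg by (intro fundamental_theorem_of_algebra) (simp add: constant_degree)
  ultimately show "finite {cmod s | s :: complex. s ^ (d + 1) - s ^ d + complex_of_real c = 0}"
    and "{cmod s | s :: complex. s ^ (d + 1) - s ^ d + complex_of_real c = 0} \<noteq> {}" by auto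
qed

text \<open>
  If \<open>s \<noteq> x\<close> is another root, subtracting the two equations and dividing by \<open>s - x\<close> gives
  \<open>s ^ d = (1 - x) * (\<Sum>i<d. x ^ (d - 1 - i) * s ^ i)\<close>. When \<open>cmod s > x\<close> the sum is at most
  \<open>d * cmod s ^ (d - 1)\<close> in modulus, hence \<open>cmod s \<le> (1 - x) * d < d / (d + 1) < x\<close>.
\<close>
lemma real_root_dominates:
  fixes s :: complex and x :: real
  assumes d: "d > 0" and x: "real d / real (d + 1) < x"
    and xr: "x ^ d * (1 - x) = c"
    and root: "s ^ (d + 1) - s ^ d + complex_of_real c = 0"
    and x1: "x \<le> 1"
  shows "cmod s \<le> x"
proof (rule ccontr)
  assume "\<not> cmod s \<le> x"
  then have gt: "x < cmod s" by simp
  have x0: "0 < x" using x by (meson divide_nonneg_nonneg le_less_trans of_nat_0_le_iff)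
  let ?x = "complex_of_real x"
  define T where "T = (\<Sum>i<d. ?x ^ (d - Suc i) * s ^ i)"
  have ne: "s \<noteq> ?x" using gt x0 by auto
  have c: "complex_of_real c = ?x ^ d * (1 - ?x)" unfolding xr[symmetric] by simp
  have T: "s ^ d - ?x ^ d = (s - ?x) * T" unfolding T_def by (rule power_diff_sumr2)
  have "(s - ?x) * (s ^ d - (1 - ?x) * T) = s ^ d * (s - ?x) - (1 - ?x) * ((s - ?x) * T)"
    by (simp add: algebra_simps)
  also have "\<dots> = s ^ (d + 1) - s ^ d + ?x ^ d * (1 - ?x)"
    unfolding T[symmetric] by (simp add: algebra_simps)
  also have "\<dots> = 0" using root c by simp
  finally have sd: "s ^ d = (1 - ?x) * T" using ne by simp
  have "cmod T \<le> (\<Sum>i<d. cmod (?x ^ (d - Suc i) * s ^ i))" unfolding T_def by (rule norm_sum)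
  also have "\<dots> \<le> (\<Sum>i<d. cmod s ^ (d - 1))"
  proof (rule sum_mono)
    fix i assume "i \<in> {..<d}"
    then have e: "d - 1 = (d - Suc i) + i" by auto
    have "cmod (?x ^ (d - Suc i) * s ^ i) = x ^ (d - Suc i) * cmod s ^ i"
      using x0 by (simp add: norm_mult norm_power)
    also have "\<dots> \<le> cmod s ^ (d - Suc i) * cmod s ^ i"
      using x0 gt by (intro mult_right_mono power_mono) auto
    finally show "cmod (?x ^ (d - Suc i) * s ^ i) \<le> cmod s ^ (d - 1)"
      unfolding e power_add .
  qed
  finally have Tb: "cmod T \<le> real d * cmod s ^ (d - 1)" by simp
  have "cmod (1 - ?x) = 1 - x" using x1
    by (metis abs_of_nonneg diff_ge_0_iff_ge norm_of_real of_real_1 of_real_diff)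
  then have "cmod s * cmod s ^ (d - 1) = (1 - x) * cmod T"
    using arg_cong[OF sd, of cmod] d by (simp add: norm_power norm_mult power_eq_if[of _ d])
  also have "\<dots> \<le> ((1 - x) * real d) * cmod s ^ (d - 1)"
    using mult_left_mono[OF Tb, of "1 - x"] x1 by (simp add: mult.assoc)
  finally have "cmod s \<le> (1 - x) * real d"
    by (rule mult_right_le_imp_le) (use less_trans[OF x0 gt] in \<open>rule zero_less_power\<close>)
  moreover have "(1 - x) * real d < real d / real (d + 1)"
  proof -
    have "1 - x < 1 / real (d + 1)" using x by (simp add: field_simps)
    then show ?thesis using mult_strict_right_mono[of "1 - x" "1 / real (d + 1)" "real d"] d by simp
  qed
  ultimately show False using gt x by linarith
qed

lemma dominant_real_root:
  assumes d: "d > 0" and c: "0 < c" "c < real d ^ d / real (d + 1) ^ (d + 1)"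
  obtains x where "real d / real (d + 1) < x" "x < 1" "x ^ d * (1 - x) = c" "scalar_conv_factor d c = x"
proof -
  let ?m = "real d / real (d + 1)"
  have m: "?m ^ d * (1 - ?m) = real d ^ d / real (d + 1) ^ (d + 1)"
    by (simp add: field_simps)
  have "\<exists>x\<ge>?m. x \<le> 1 \<and> x ^ d * (1 - x) = c"
    by (rule IVT2') (use c m in \<open>auto intro!: continuous_intros simp del: of_nat_add of_nat_Suc\<close>)
  then obtain x where x: "?m \<le> x" "x \<le> 1" "x ^ d * (1 - x) = c" by blast
  have xm: "x \<noteq> ?m" using m x c by (metis less_irrefl)
  have x1: "x \<noteq> 1" using x c by auto
  have lt: "?m < x" "x < 1" using x xm x1 by auto
  have x0: "0 < x" using lt by (meson divide_nonneg_nonneg le_less_trans of_nat_0_le_iff)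
  have "scalar_conv_factor d c = x"
    unfolding scalar_conv_factor_def
  proof (rule Max_eqI)
    show "finite {cmod s |s. s ^ (d + 1) - s ^ d + complex_of_real c = 0}"
      by (rule root_moduli_finite_nonempty)
    show "y \<le> x" if "y \<in> {cmod s |s. s ^ (d + 1) - s ^ d + complex_of_real c = 0}" for y
      using that real_root_dominates[OF d lt(1) x(3) _ x(2)] by blast
    have "complex_of_real x ^ (d + 1) - complex_of_real x ^ d + complex_of_real c = 0"
      unfolding x(3)[symmetric] by (simp add: algebra_simps)
    then show "x \<in> {cmod s |s. s ^ (d + 1) - s ^ d + complex_of_real c = 0}"
      using x0 by (auto intro!: exI[of _ "complex_of_real x"])
  qed
  then show ?thesis using that lt x by blast
qed

text \<open>
  The factors \<open>x\<close> for \<open>d\<close> and \<open>y\<close> for \<open>e\<close> are dominant real roots. As \<open>x < 1\<close>, raising the exponent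
  from \<open>d\<close> to \<open>e\<close> pushes \<open>x ^ e * (1 - x)\<close> below \<open>c = y ^ e * (1 - y)\<close>. This yields \<open>y < x\<close> only on the
  decreasing part of \<open>t ^ e * (1 - t)\<close>, so \<open>x\<close> must exceed the critical point \<open>e / (e + 1)\<close> too. That
  is where the threshold for the larger exponent enters.
\<close>
lemma scalar_conv_factor_decreasing:
  assumes de: "0 < d" "d < e" and c: "0 < c"
    and cd: "c < real d ^ d / real (d + 1) ^ (d + 1)" and ce: "c < real e ^ e / real (e + 1) ^ (e + 1)"
  shows "scalar_conv_factor e c < scalar_conv_factor d c"
proof -
  have e0: "0 < e" using de by simp
  let ?n = "real e / real (e + 1)"
  obtain x where x: "real d / real (d + 1) < x" "x < 1" "x ^ d * (1 - x) = c" "scalar_conv_factor d c = x"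
    using dominant_real_root[OF de(1) c cd] by blast
  obtain y where y: "?n < y" "y < 1" "y ^ e * (1 - y) = c" "scalar_conv_factor e c = y"
    using dominant_real_root[OF e0 c ce] by blast
  have n: "0 < ?n" "?n < 1" using e0 by auto
  have nx: "?n < x"
  proof (rule ccontr)
    assume "\<not> ?n < x"
    then have "?n ^ d * (1 - ?n) \<le> x ^ d * (1 - x)"
      using power_times_complement_strict_antimono[OF de(1) less_imp_le[OF x(1)], of ?n]
      by (cases "x = ?n") auto
    moreover have "?n ^ e * (1 - ?n) \<le> ?n ^ d * (1 - ?n)"
      using n de by (intro mult_right_mono power_decreasing) auto
    moreover have "?n ^ e * (1 - ?n) = real e ^ e / real (e + 1) ^ (e + 1)"
      by (simp add: field_simps)
    ultimately show False using ce x by linarith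
  qed
  have "x ^ e < x ^ d" using x(2) less_trans[OF n(1) nx] de by (intro power_strict_decreasing) auto
  then have "x ^ e * (1 - x) < x ^ d * (1 - x)" using x by (intro mult_strict_right_mono) auto
  then have "x ^ e * (1 - x) < y ^ e * (1 - y)" using x y by simp
  moreover have "y ^ e * (1 - y) \<le> x ^ e * (1 - x)" if "x \<le> y"
    using power_times_complement_strict_antimono[OF e0 less_imp_le[OF nx], of y] that
    by (cases "x = y") auto
  ultimately show ?thesis using x y by force
qed

lemma scalar_conv_factor_0: "scalar_conv_factor 0 c = \<bar>1 - c\<bar>"
proof -
  have "s ^ (0 + 1) - s ^ 0 + complex_of_real c = 0 \<longleftrightarrow> s = complex_of_real (1 - c)" for s
    by (auto simp: algebra_simps)
  then have "{cmod s |s. s ^ (0 + 1) - s ^ 0 + complex_of_real c = 0} = {\<bar>1 - c\<bar>}"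
    using norm_of_real[of "1 - c", where 'a = complex] by (auto simp del: norm_of_real)
  then show ?thesis unfolding scalar_conv_factor_def by simp
qed

text \<open>
  With \<open>\<rho> = \<bar>1 - c\<bar>\<close>, the second term of the minimum says \<open>\<rho> > d / (d + 1)\<close>, and the first, after
  taking exponentials with \<open>ln \<rho> < 0\<close>, is the upper bound on \<open>c\<close> in \<open>roots_inside_disc\<close>. The lower
  bound there is automatic because \<open>1 - \<rho> \<le> c\<close>.
\<close>
lemma buffer_condition_accelerates:
  assumes d: "d > 0" and c: "0 < c" "c < 2"
    and ph: "is_phase d \<bar>1 - c\<bar> \<phi>" and bc: "buffer_condition d c \<phi>"
  shows "scalar_conv_factor d c < scalar_conv_factor 0 c"
proof -
  define \<rho> where "\<rho> = \<bar>1 - c\<bar>"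
  define S where "S = sqrt (1 + \<rho>\<^sup>2 - 2 * \<rho> * cos \<phi>)"
  have \<rho>1: "\<rho> < 1" using c by (auto simp: \<rho>_def)
  have "(1 - c)\<^sup>2 + 1 - 2 * \<bar>1 - c\<bar> * cos \<phi> = 1 + \<rho>\<^sup>2 - 2 * \<rho> * cos \<phi>" by (simp add: \<rho>_def)
  then have "buffer_condition d c \<phi> \<longleftrightarrow> real d < min (ln (c / S) / ln \<rho>) (\<rho> / (1 - \<rho>))"
    unfolding buffer_condition_def S_def by (simp only: \<rho>_def)
  then have b1: "real d < ln (c / S) / ln \<rho>" and b2: "real d < \<rho> / (1 - \<rho>)"
    using bc by auto
  have low: "real d / real (d + 1) < \<rho>" using b2 \<rho>1 by (simp add: field_simps)
  have \<rho>0: "0 < \<rho>" using low by (meson divide_nonneg_nonneg le_less_trans of_nat_0_le_iff)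
  have "0 < (1 - \<rho>)\<^sup>2" using \<rho>1 by simp
  also have "\<dots> \<le> 1 + \<rho>\<^sup>2 - 2 * \<rho> * cos \<phi>"
    using mult_left_mono[OF cos_le_one[of \<phi>], of "2 * \<rho>"] \<rho>0 by (simp add: power2_eq_square algebra_simps)
  finally have S: "0 < S" by (simp add: S_def)
  have "ln (c / S) < real d * ln \<rho>"
    using b1 \<rho>0 \<rho>1 by (simp add: neg_less_divide_eq)
  also have "\<dots> = ln (\<rho> ^ d)" using \<rho>0 by (simp add: ln_realpow)
  finally have "c / S < \<rho> ^ d" using c S \<rho>0 by simp
  then have upper: "c < \<rho> ^ d * S" using S by (simp add: field_simps)
  have "\<rho> ^ d < 1" using \<rho>0 \<rho>1 d by (simp add: power_less_one_iff)
  then have "\<rho> ^ d * (1 - \<rho>) < 1 - \<rho>" using \<rho>1 by simp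
  also have "\<dots> \<le> c" by (auto simp: \<rho>_def)
  finally have lower: "\<rho> ^ d * (1 - \<rho>) < c" .
  have q: "sin (real d * \<phi>) / sin (real (d + 1) * \<phi>) = \<rho>" and r: "0 \<le> \<phi>" "\<phi> \<le> pi / real (d + 1)"
    using ph by (auto simp: is_phase_def \<rho>_def)
  have ne: "sin (real (d + 1) * \<phi>) \<noteq> 0" using q \<rho>0 by auto
  have "\<phi> \<noteq> 0" using ne by auto
  moreover have "real (d + 1) * \<phi> \<noteq> pi" using ne by (metis sin_pi)
  moreover have "real (d + 1) * \<phi> \<le> pi" using r by (simp add: field_simps)
  ultimately have \<phi>: "0 < \<phi>" "real (d + 1) * \<phi> < pi" using r by auto
  have branch: "\<rho> * sin (real (d + 1) * \<phi>) = sin (real d * \<phi>)" using q ne by (simp add: field_simps)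
  have "cmod s < \<rho>" if "s ^ (d + 1) - s ^ d + complex_of_real c = 0" for s
    using roots_inside_disc[OF d low \<phi> branch lower _ that c(1)] upper unfolding S_def by blast
  then have "scalar_conv_factor d c < \<rho>"
    unfolding scalar_conv_factor_def
    by (subst Max_less_iff) (use root_moduli_finite_nonempty[of d c] in auto)
  then show ?thesis by (simp add: scalar_conv_factor_0 \<rho>_def)
qed

section \<open>The spectrum of a connected Laplacian\<close>

text \<open>
  The first two columns of the basis in which the matrix is upper triangular. For
  \<open>p = q\<close> they span a Jordan block unless \<open>b = 0\<close>.
\<close>
lemma schur_leading_pair:
  fixes A :: "real mat"
  assumes A: "A \<in> carrier_mat n n"
    and cp: "char_poly A = (\<Prod>e\<leftarrow>p # q # es. [:- e, 1:])"
    and n: "n \<ge> 2"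
  obtains u v :: "nat \<Rightarrow> real" and b :: real
  where "\<And>i. i < n \<Longrightarrow> (\<Sum>j<n. A $$ (i, j) * u j) = p * u i"
    and "\<And>i. i < n \<Longrightarrow> (\<Sum>j<n. A $$ (i, j) * v j) = b * u i + q * v i"
    and "\<And>x y. (\<And>i. i < n \<Longrightarrow> x * u i + y * v i = 0) \<Longrightarrow> x = 0 \<and> y = 0"
proof -
  obtain B P Q where sd: "schur_decomposition A (p # q # es) = (B, P, Q)"
    using prod_cases3 by blast
  from schur_decomposition[OF A cp sd]
  have w: "similar_mat_wit A B P Q" and ut: "upper_triangular B" and dg: "diag_mat B = p # q # es"
    by auto
  note D = similar_mat_witD2[OF A w]
  have c: "B \<in> carrier_mat n n" "P \<in> carrier_mat n n" "Q \<in> carrier_mat n n" using D by auto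
  have "A * P = P * B * (Q * P)"
    using D(3) c by (simp add: assoc_mult_mat[of _ n n _ n _ n])
  then have AP: "A * P = P * B" using D(2) c by simp
  have b00: "B $$ (0, 0) = p" and b11: "B $$ (1, 1) = q"
    using arg_cong[OF dg, of "\<lambda>l. l ! 0"] arg_cong[OF dg, of "\<lambda>l. l ! 1"] c n
    by (auto simp: diag_mat_def)
  have entry: "(X * Y) $$ (i, k) = (\<Sum>j<n. X $$ (i, j) * Y $$ (j, k))"
    if "X \<in> carrier_mat n n" "Y \<in> carrier_mat n n" "i < n" "k < n" for X Y :: "real mat" and i k
    using that by (auto simp: scalar_prod_def atLeast0LessThan)
  have low: "B $$ (j, k) = 0" if "k < j" "j < n" for j k
    using ut c that by (auto simp: upper_triangular_def)
  have col0: "(\<Sum>j<n. A $$ (i, j) * P $$ (j, 0)) = p * P $$ (i, 0)" if i: "i < n" for i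
  proof -
    have "(\<Sum>j<n. A $$ (i, j) * P $$ (j, 0)) = (\<Sum>j<n. P $$ (i, j) * B $$ (j, 0))"
      using entry[OF A c(2) i, of 0] entry[OF c(2) c(1) i, of 0] n by (simp add: AP)
    also have "\<dots> = (\<Sum>j\<in>{0}. P $$ (i, j) * B $$ (j, 0))"
      using low n by (intro sum.mono_neutral_right) auto
    finally show ?thesis by (simp add: b00)
  qed
  have col1: "(\<Sum>j<n. A $$ (i, j) * P $$ (j, 1)) = B $$ (0, 1) * P $$ (i, 0) + q * P $$ (i, 1)"
    if i: "i < n" for i
  proof -
    have "(\<Sum>j<n. A $$ (i, j) * P $$ (j, 1)) = (\<Sum>j<n. P $$ (i, j) * B $$ (j, 1))"
      using entry[OF A c(2) i, of 1] entry[OF c(2) c(1) i, of 1] n by (simp add: AP)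
    also have "\<dots> = (\<Sum>j\<in>{0, 1}. P $$ (i, j) * B $$ (j, 1))"
      using low n by (intro sum.mono_neutral_right) auto
    finally show ?thesis using b11 by simp
  qed
  have indep: "x = 0 \<and> y = 0" if xy: "\<And>i. i < n \<Longrightarrow> x * P $$ (i, 0) + y * P $$ (i, 1) = 0" for x y
  proof -
    have "x * (Q * P) $$ (k, 0) + y * (Q * P) $$ (k, 1) = 0" if k: "k < n" for k
    proof -
      have "x * (Q * P) $$ (k, 0) + y * (Q * P) $$ (k, 1)
          = (\<Sum>j<n. Q $$ (k, j) * (x * P $$ (j, 0) + y * P $$ (j, 1)))"
        using entry[OF c(3) c(2) k, of 0] entry[OF c(3) c(2) k, of 1] n
        by (simp add: sum_distrib_left sum.distrib algebra_simps)
      also have "\<dots> = 0" using xy by simp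
      finally show ?thesis .
    qed
    from this[of 0] this[of 1] show ?thesis using D(2) n by simp
  qed
  show ?thesis by (rule that[OF col0 col1 indep])
qed

lemma laplacian_apply:
  assumes A: "A \<in> carrier_mat N N" and i: "i < N"
  shows "(\<Sum>j<N. laplacian A $$ (i, j) * w j) = (\<Sum>j<N. A $$ (i, j) * (w i - w j))"
proof -
  have entry: "laplacian A $$ (i, j) = (if i = j then \<Sum>k<N. A $$ (i, k) else 0) - A $$ (i, j)"
    if "j < N" for j
    using A i that
    by (auto simp: laplacian_def mat_diag_def scalar_prod_def atLeast0LessThan)
  have "(\<Sum>j<N. laplacian A $$ (i, j) * w j)
      = (\<Sum>j<N. (if i = j then (\<Sum>k<N. A $$ (i, k)) * w j else 0) - A $$ (i, j) * w j)"
    by (intro sum.cong) (auto simp: entry algebra_simps)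
  also have "\<dots> = (\<Sum>k<N. A $$ (i, k)) * w i - (\<Sum>j<N. A $$ (i, j) * w j)"
    using i by (simp add: sum_subtractf)
  finally show ?thesis by (simp add: sum_distrib_left sum_subtractf right_diff_distrib left_diff_distrib mult.commute)
qed

text \<open>
  Symmetrising the double sum in \<open>i\<close> and \<open>j\<close>. For nonnegative weights the result shows at
  once that the Laplacian is self-adjoint and positive semidefinite.
\<close>
lemma dirichlet_form:
  fixes a :: "nat \<Rightarrow> nat \<Rightarrow> real"
  assumes sym: "\<And>i j. i < N \<Longrightarrow> j < N \<Longrightarrow> a i j = a j i"
  shows "(\<Sum>i<N. f i * (\<Sum>j<N. a i j * (g i - g j)))
       = (\<Sum>i<N. \<Sum>j<N. a i j * ((f i - f j) * (g i - g j))) / 2"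
proof -
  let ?S = "\<Sum>i<N. \<Sum>j<N. a i j * f i * (g i - g j)"
  have "?S = (\<Sum>i<N. \<Sum>j<N. a j i * f j * (g j - g i))" by (rule sum.swap)
  also have "\<dots> = - (\<Sum>i<N. \<Sum>j<N. a i j * f j * (g i - g j))"
    unfolding sum_negf[symmetric] using sym by (intro sum.cong) (auto simp: algebra_simps)
  finally have "2 * ?S = ?S - (\<Sum>i<N. \<Sum>j<N. a i j * f j * (g i - g j))" by simp
  also have "\<dots> = (\<Sum>i<N. \<Sum>j<N. a i j * ((f i - f j) * (g i - g j)))"
    unfolding sum_subtractf[symmetric] by (intro sum.cong) (auto simp: algebra_simps)
  finally show ?thesis by (simp add: sum_distrib_left mult_ac)
qed

lemma connected_constant:
  assumes G: "connected_weighted_graph G N A"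
    and arc: "\<And>i j. (i, j) \<in> parcs G \<Longrightarrow> w i = w j"
    and i: "i < N" "j < N"
  shows "w i = w j"
proof -
  let ?H = "with_proj (mk_symmetric (with_proj G))"
  have "i \<rightarrow>\<^sup>*\<^bsub>?H\<^esub> j"
    using G i by (auto simp: connected_weighted_graph_def Digraph_Component.connected_def strongly_connected_def)
  then have "(i, j) \<in> (arcs_ends ?H)\<^sup>*" by (rule reachable_rtranclI)
  then show ?thesis
  proof (induction rule: rtrancl_induct)
    case (step x y)
    then show ?case using arc by (auto simp: parcs_mk_symmetric)
  qed simp
qed

lemma adjacency_matrix_entries:
  assumes G: "connected_weighted_graph G N A"
  shows "A \<in> carrier_mat N N"
    and "i < N \<Longrightarrow> j < N \<Longrightarrow> A $$ (i, j) = A $$ (j, i)"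
    and "i < N \<Longrightarrow> j < N \<Longrightarrow> 0 \<le> A $$ (i, j)"
    and "(i, j) \<in> parcs G \<Longrightarrow> i < N \<and> j < N \<and> 0 < A $$ (i, j)"
proof -
  have adj: "adjacency_matrix_of G N A" and pg: "pair_graph G" and V: "pverts G = {0..<N}"
    using G by (auto simp: connected_weighted_graph_def)
  interpret pair_graph G by (rule pg)
  show "A \<in> carrier_mat N N" using adj by (simp add: adjacency_matrix_of_def)
  show "A $$ (i, j) = A $$ (j, i)" if "i < N" "j < N"
    using adj that unfolding adjacency_matrix_of_def by metis
  show "0 \<le> A $$ (i, j)" if "i < N" "j < N"
    using adj that unfolding adjacency_matrix_of_def by (metis less_eq_real_def)
  show "i < N \<and> j < N \<and> 0 < A $$ (i, j)" if ij: "(i, j) \<in> parcs G"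
  proof -
    have "i < N" "j < N" using V arc_fst_in_verts[OF ij] arc_snd_in_verts[OF ij] by auto
    then show ?thesis using adj ij unfolding adjacency_matrix_of_def by auto
  qed
qed

text \<open>
  The Dirichlet form of \<open>w\<close> vanishes, hence so does every summand, and the positive weights
  force \<open>w\<close> to agree along arcs.
\<close>
lemma laplacian_kernel_constant:
  assumes G: "connected_weighted_graph G N A"
    and ker: "\<And>i. i < N \<Longrightarrow> (\<Sum>j<N. A $$ (i, j) * (w i - w j)) = 0"
    and i: "i < N" "j < N"
  shows "w i = w j"
proof (rule connected_constant[OF G _ i])
  note adj = adjacency_matrix_entries[OF G]
  have "(\<Sum>i<N. \<Sum>j<N. A $$ (i, j) * ((w i - w j) * (w i - w j))) = 0"
    using dirichlet_form[of N "\<lambda>i j. A $$ (i, j)" w w] adj(2) ker by simp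
  then have "(\<Sum>j<N. A $$ (i, j) * ((w i - w j) * (w i - w j))) = 0" if "i < N" for i
    using that adj(3)
    by (subst (asm) sum_nonneg_eq_0_iff) (auto intro!: sum_nonneg)
  then have z: "A $$ (i, j) * ((w i - w j) * (w i - w j)) = 0" if "i < N" "j < N" for i j
    using sum_nonneg_eq_0_iff[of "{..<N}" "\<lambda>j. A $$ (i, j) * ((w i - w j) * (w i - w j))"]
      that adj(3) by auto
  show "w i = w j" if ij: "(i, j) \<in> parcs G" for i j
    using adj(4)[OF ij] z[of i j] by auto
qed

text \<open>
  Eigenvalues are counted with algebraic multiplicity, so a one-dimensional kernel alone is not
  enough: a Jordan block at \<open>0\<close> has to be excluded as well. If \<open>lam 2 \<le> 0\<close>, then semidefiniteness on
  the first Schur vector \<open>u\<close> gives \<open>lam 1 = lam 2 = 0\<close>. Pairing \<open>L v = b u\<close> with \<open>u\<close> and using symmetry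
  gives \<open>b = 0\<close>. Then \<open>u\<close> and \<open>v\<close> are both in the kernel, hence constant and linearly dependent.
\<close>
lemma laplacian_second_eigenvalue_pos:
  assumes N: "N \<ge> 2" and G: "connected_weighted_graph G N A"
    and ev: "ordered_eigenvalues (laplacian A) N lam"
  shows "0 < lam 2"
proof (rule ccontr)
  assume "\<not> 0 < lam 2"
  then have l2: "lam 2 \<le> 0" by simp
  have "lam 1 \<le> lam 2"
    using ev N unfolding ordered_eigenvalues_def by (auto dest!: mono_onD[of _ _ 1 2])
  then have l1: "lam 1 \<le> 0" using l2 by simp
  note symm = adjacency_matrix_entries(2)[OF G] and nonneg = adjacency_matrix_entries(3)[OF G]
  have A: "A \<in> carrier_mat N N" by (rule adjacency_matrix_entries(1)[OF G])
  then have L: "laplacian A \<in> carrier_mat N N" by (auto simp: laplacian_def)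
  have "[1..<Suc N] = 1 # 2 # [3..<Suc N]" using N by (simp add: upt_conv_Cons numeral_eq_Suc del: upt_Suc)
  moreover have "(\<Prod>i\<in>{1..N}. [:- lam i, 1:]) = (\<Prod>i\<leftarrow>[1..<Suc N]. [:- lam i, 1:])"
    by (subst prod.distinct_set_conv_list[symmetric])
      (auto simp: atLeastLessThanSuc_atLeastAtMost simp del: upt_Suc)
  ultimately have "char_poly (laplacian A) = (\<Prod>e\<leftarrow>lam 1 # lam 2 # map lam [3..<Suc N]. [:- e, 1:])"
    using ev unfolding ordered_eigenvalues_def by (simp add: o_def del: upt_Suc)
  from schur_leading_pair[OF L this N]
  obtain u v b where
    u': "\<And>i. i < N \<Longrightarrow> (\<Sum>j<N. laplacian A $$ (i, j) * u j) = lam 1 * u i" and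
    v': "\<And>i. i < N \<Longrightarrow> (\<Sum>j<N. laplacian A $$ (i, j) * v j) = b * u i + lam 2 * v i" and
    indep: "\<And>x y. (\<And>i. i < N \<Longrightarrow> x * u i + y * v i = 0) \<Longrightarrow> x = 0 \<and> y = 0"
    by blast
  have u: "(\<Sum>j<N. A $$ (i, j) * (u i - u j)) = lam 1 * u i"
    and v: "(\<Sum>j<N. A $$ (i, j) * (v i - v j)) = b * u i + lam 2 * v i" if "i < N" for i
    using u'[OF that] v'[OF that] laplacian_apply[OF A that] by simp_all
  have upos: "(\<Sum>i<N. u i * u i) > 0"
  proof (rule ccontr)
    assume "\<not> ?thesis"
    then have "(\<Sum>i<N. u i * u i) = 0"
      using sum_nonneg[of "{..<N}" "\<lambda>i. u i * u i"] by simp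
    then have "u i = 0" if "i < N" for i
      using that by (subst (asm) sum_nonneg_eq_0_iff) auto
    then show False using indep[of 1 0] by simp
  qed
  have "lam 1 * (\<Sum>i<N. u i * u i) = (\<Sum>i<N. u i * (\<Sum>j<N. A $$ (i, j) * (u i - u j)))"
    by (subst sum_distrib_left, intro sum.cong) (simp_all add: u)
  also have "\<dots> = (\<Sum>i<N. \<Sum>j<N. A $$ (i, j) * ((u i - u j) * (u i - u j))) / 2"
    by (rule dirichlet_form) (rule symm)
  also have "\<dots> \<ge> 0" using nonneg by (auto intro!: sum_nonneg divide_nonneg_pos)
  finally have "lam 1 \<ge> 0" using upos by (simp add: zero_le_mult_iff)
  then have l10: "lam 1 = 0" and l20: "lam 2 = 0" using l1 l2 \<open>lam 1 \<le> lam 2\<close> by auto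
  have "b * (\<Sum>i<N. u i * u i) = (\<Sum>i<N. u i * (\<Sum>j<N. A $$ (i, j) * (v i - v j)))"
    by (subst sum_distrib_left, intro sum.cong) (simp_all add: v l20)
  also have "\<dots> = (\<Sum>i<N. \<Sum>j<N. A $$ (i, j) * ((u i - u j) * (v i - v j))) / 2"
    by (rule dirichlet_form) (rule symm)
  also have "\<dots> = (\<Sum>i<N. \<Sum>j<N. A $$ (i, j) * ((v i - v j) * (u i - u j))) / 2"
    by (simp only: mult.commute[of "u i - u j" for i j])
  also have "\<dots> = (\<Sum>i<N. v i * (\<Sum>j<N. A $$ (i, j) * (u i - u j)))"
    by (rule dirichlet_form[symmetric]) (rule symm)
  also have "\<dots> = 0" using l10 by (simp add: u)
  finally have b0: "b = 0" using upos by simp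
  have ku: "(\<Sum>j<N. A $$ (i, j) * (u i - u j)) = 0" if "i < N" for i
    using u[OF that] unfolding l10 by simp
  have kv: "(\<Sum>j<N. A $$ (i, j) * (v i - v j)) = 0" if "i < N" for i
    using v[OF that] unfolding l20 b0 by simp
  have "0 < N" using N by simp
  then have cu: "u i = u 0" and cv: "v i = v 0" if "i < N" for i
    using laplacian_kernel_constant[of G N A u i 0, OF G ku that]
      laplacian_kernel_constant[of G N A v i 0, OF G kv that] by blast+
  have "v 0 * u i + (- u 0) * v i = 0" if "i < N" for i
    using cu[OF that] cv[OF that] by simp
  from indep[OF this] have "u 0 = 0" by simp
  then have "u i = 0" if "i < N" for i using cu[OF that] by simp
  then show False using upos by simp
qed

section \<open>The convergence factor of the algorithm\<close>

lemma conv_factor_less: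
  assumes "N \<ge> 2"
    and "\<And>i. i \<in> {2..N} \<Longrightarrow> scalar_conv_factor e (\<delta> * lam i) < scalar_conv_factor d (\<delta> * lam i)"
  shows "conv_factor N lam \<delta> e < conv_factor N lam \<delta> d"
  unfolding conv_factor_def
proof (subst Max_less_iff)
  show "\<forall>a\<in>(\<lambda>i. scalar_conv_factor e (\<delta> * lam i)) ` {2..N}.
      a < Max ((\<lambda>i. scalar_conv_factor d (\<delta> * lam i)) ` {2..N})"
    using assms(2) by (auto intro!: less_le_trans[OF assms(2)])
qed (use assms(1) in auto)

lemma mode_gain_bounds:
  assumes N: "N \<ge> 2" and G: "connected_weighted_graph G N A"
    and ev: "ordered_eigenvalues (laplacian A) N lam"
    and \<delta>: "0 < \<delta>" "\<delta> < 2 / lam N" and i: "i \<in> {2..N}"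
  shows "0 < \<delta> * lam i" "\<delta> * lam i < 2"
proof -
  have mono: "mono_on {1..N} lam" using ev by (simp add: ordered_eigenvalues_def)
  have "0 < lam 2" by (rule laplacian_second_eigenvalue_pos[OF N G ev])
  also have "lam 2 \<le> lam i" using mono i by (intro mono_onD[of _ lam]) auto
  finally have p: "0 < lam i" .
  have le: "lam i \<le> lam N" using mono i by (intro mono_onD[of _ lam]) auto
  show "0 < \<delta> * lam i" using p \<delta> by simp
  have "\<delta> * lam i \<le> \<delta> * lam N" using le \<delta> by simp
  also have "\<dots> < 2" using \<delta> p le by (simp add: field_simps)
  finally show "\<delta> * lam i < 2" .
qed

theorem mainTheorem1:
  fixes N :: nat and G :: "nat pair_pre_digraph" and A :: "real mat"
    and lam :: "nat \<Rightarrow> real" and \<delta> :: real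
  assumes "N \<ge> 2"
    and "connected_weighted_graph G N A"
    and "ordered_eigenvalues (laplacian A) N lam"
    and "0 < \<delta>" and "\<delta> < 2 / lam N"
  shows "(\<forall>d>0. \<forall>\<phi> :: nat \<Rightarrow> real.
            (\<forall>i\<in>{2..N}. is_phase d \<bar>1 - \<delta> * lam i\<bar> (\<phi> i) \<and> buffer_condition d (\<delta> * lam i) (\<phi> i))
            \<longrightarrow> conv_factor N lam \<delta> d < conv_factor N lam \<delta> 0) \<and>
         strict_antimono_on
           {d. d > 0 \<and> (\<forall>i\<in>{2..N}. \<delta> * lam i < real d ^ d / real (d + 1) ^ (d + 1))}
           (conv_factor N lam \<delta>)"
proof (intro conjI allI impI)
  note gain = mode_gain_bounds[OF assms]
  show "conv_factor N lam \<delta> d < conv_factor N lam \<delta> 0"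
    if "d > 0"
      and "\<forall>i\<in>{2..N}. is_phase d \<bar>1 - \<delta> * lam i\<bar> (\<phi> i) \<and> buffer_condition d (\<delta> * lam i) (\<phi> i)"
    for d and \<phi> :: "nat \<Rightarrow> real"
    using that gain
    by (intro conv_factor_less[OF assms(1)] buffer_condition_accelerates) auto
  show "strict_antimono_on
      {d. d > 0 \<and> (\<forall>i\<in>{2..N}. \<delta> * lam i < real d ^ d / real (d + 1) ^ (d + 1))}
      (conv_factor N lam \<delta>)"
  proof (rule monotone_onI)
    fix d e
    assume "d \<in> {d. d > 0 \<and> (\<forall>i\<in>{2..N}. \<delta> * lam i < real d ^ d / real (d + 1) ^ (d + 1))}"
      and "e \<in> {d. d > 0 \<and> (\<forall>i\<in>{2..N}. \<delta> * lam i < real d ^ d / real (d + 1) ^ (d + 1))}"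
      and "d < e"
    then show "conv_factor N lam \<delta> e < conv_factor N lam \<delta> d"
      using gain by (intro conv_factor_less[OF assms(1)] scalar_conv_factor_decreasing) blast+
  qed
qed

end
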